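(* Let $X$ and $Y$ be Banach spaces, let $D_F\subseteq X$ be open, and let $F:D_F\to Y$ be continuously (Fréchet) differentiable. Let $x_0\in D_F$ be such that $F'(x_0)$ is invertible with $(F'(x_0))^{-1}\in L(Y,X)$. Let $\eta>0$ and $R>0$ be constants with $\bar B(x_0,R)\subset D_F$, and let $\omega_0:[0,R]\to[0,\infty)$ be a continuous non-decreasing function with $\omega_0(0)=0$, such that $$\|(F'(x_0))^{-1}F(x_0)\|\le \eta$$ and $$\|(F'(x_0))^{-1}(F'(x)-F'(x_0))\|\le \omega_0(r)\qquad\text{whenever } \|x-x_0\|\le r\le R .$$ Suppose that the formula $$\psi(\upsilon)=\eta+2\bigl(1-\omega_0(\upsilon)\bigr)^{-1}\int_0^{\upsilon}\omega_0(l)\,dl$$ defines a continuous non-decreasing function $\psi$ on $[0,R]$ with $\psi\geq 0$, and that the fixed point equation $\upsilon=\psi(\upsilon)$ has a minimal solution $\upsilon_*$ satisfying $\eta<\upsilon_*\le R$. Let the scalar sequence $\{\upsilon_k\}_{k\ge 0}$ be generated by $\upsilon_0=0$, $\upsilon_1=\psi(0)=\eta$ and $\upsilon_{k+1}=\psi(\upsilon_k)$ for all $k\ge 0$. Then the Newton sequence $\{x_k\}_{k\geq 0}$ started at $x_0$, $$x_{k+1}=x_k-(F'(x_k))^{-1}F(x_k),\qquad k\ge 0,$$ is well-defined, remains in $\bar B(x_0,\upsilon_* )$, and converges to a solution $x_*$ of the equation $F(x)=0$. Moreover, for all $k\ge 0$, $$\|x_{k+1}-x_k\|\le \upsilon_{k+1}-\upsilon_k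 \qquad\text{and}\qquad \|x_*-x_k\|\le \upsilon_*-\upsilon_k ,$$ and the scalar sequence $\{\upsilon_k\}$ is non-decreasing and converges to the minimal solution $\upsilon_*$ of $\upsilon=\psi(\upsilon)$.
   Context: $L(Y,X)$ denotes the space of bounded linear operators from $Y$ to $X$. $\bar B(x_0,r)=\{x\in X:\|x-x_0\|\le r\}$ is the closed ball of center $x_0$ and radius $r$. $F'(x)$ is the Fréchet derivative of $F$ at $x$, and the norms of linear operators are operator norms. "Minimal solution" of $\upsilon=\psi(\upsilon)$ means the smallest solution in $[0,R]$. The hypothesis that the formula defines $\psi$ on $[0,R]$ includes that $1-\omega_0(\upsilon)\neq 0$ for $\upsilon\in[0,R]$. The Newton sequence is "well-defined" if for every $k\ge 0$ one has $x_k\in D_F$ and $F'(x_k)$ is invertible with bounded inverse. *)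

theory Defs
  imports "HOL-Analysis.Analysis"
begin

definition is_blinfun_inverse ::
    "('a::real_normed_vector \<Rightarrow>\<^sub>L 'b::real_normed_vector) \<Rightarrow> ('b \<Rightarrow>\<^sub>L 'a) \<Rightarrow> bool"
  where "is_blinfun_inverse A B \<longleftrightarrow> B o\<^sub>L A = id_blinfun \<and> A o\<^sub>L B = id_blinfun"

definition blinfun_invertible ::
    "('a::real_normed_vector \<Rightarrow>\<^sub>L 'b::real_normed_vector) \<Rightarrow> bool"
  where "blinfun_invertible A \<longleftrightarrow> (\<exists>B. is_blinfun_inverse A B)"

text \<open>A two-sided inverse is unique, so this is the inverse whenever
  \<^term>\<open>blinfun_invertible A\<close> holds; otherwise the value is unspecified.\<close>

definition blinfun_inv ::
    "('a::real_normed_vector \<Rightarrow>\<^sub>L 'b::real_normed_vector) \<Rightarrow> ('b \<Rightarrow>\<^sub>L 'a)"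
  where "blinfun_inv A = (THE B. is_blinfun_inverse A B)"

text \<open>This recursion is total. Newton's method is meaningful for the iterates only if each
  of them lies in the domain of \<open>F\<close> and has an invertible derivative, which has to be
  stated separately.\<close>

primrec newton_seq ::
    "('a::real_normed_vector \<Rightarrow> 'b::real_normed_vector) \<Rightarrow> ('a \<Rightarrow> 'a \<Rightarrow>\<^sub>L 'b) \<Rightarrow> 'a \<Rightarrow> nat \<Rightarrow> 'a"
  where
    "newton_seq F F' x0 0 = x0"
  | "newton_seq F F' x0 (Suc k) =
       newton_seq F F' x0 k
       - blinfun_apply (blinfun_inv (F' (newton_seq F F' x0 k))) (F (newton_seq F F' x0 k))"

end

theory Submission
  imports Defs
begin

text \<open>
  Write \<open>L\<close> for the inverse of \<open>F' x0\<close>. The Newton equation at \<open>x\<^sub>k\<^sub>-\<^sub>1\<close> turns \<open>F x\<^sub>k\<close> into the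
  linearisation error of \<open>F\<close> at \<open>x\<^sub>k\<^sub>-\<^sub>1\<close>. Comparing both \<open>F'\<close> on the segment and \<open>F' x\<^sub>k\<^sub>-\<^sub>1\<close> with \<open>F' x0\<close>
  bounds \<open>\<parallel>L (F x\<^sub>k)\<parallel>\<close> by twice the integral of \<open>\<omega>0\<close> over \<open>[\<upsilon>\<^sub>k\<^sub>-\<^sub>1, \<upsilon>\<^sub>k]\<close>. Since
  \<open>\<parallel>h\<parallel> \<le> \<parallel>L (F' x\<^sub>k h)\<parallel> / (1 - \<omega>0 \<upsilon>\<^sub>k)\<close>, and since replacing \<open>\<omega>0 \<upsilon>\<^sub>k\<^sub>-\<^sub>1\<close> by \<open>\<omega>0 \<upsilon>\<^sub>k\<close> in \<open>\<psi> \<upsilon>\<^sub>k\<^sub>-\<^sub>1\<close>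
  only increases it, the step length is at most \<open>\<psi> \<upsilon>\<^sub>k - \<psi> \<upsilon>\<^sub>k\<^sub>-\<^sub>1 = \<upsilon>\<^sub>k\<^sub>+\<^sub>1 - \<upsilon>\<^sub>k\<close>.
\<close>

section \<open>Inverses of bounded operators and their stability\<close>

lemma is_blinfun_inverse_unique:
  assumes "is_blinfun_inverse A B" and "is_blinfun_inverse A C"
  shows "B = C"
proof (rule blinfun_eqI)
  fix y
  have "A (C y) = y" "\<And>x. B (A x) = x"
    using assms unfolding is_blinfun_inverse_def
    by (metis blinfun_apply_blinfun_compose blinfun_apply_id_blinfun id_apply)+
  then show "B y = C y"
    by metis
qed

lemma blinfun_inv_inverse:
  assumes "blinfun_invertible A"
  shows "blinfun_inv A (A x) = x" and "A (blinfun_inv A y) = y"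
proof -
  obtain B where B: "is_blinfun_inverse A B"
    using assms blinfun_invertible_def by blast
  then have "blinfun_inv A = B"
    unfolding blinfun_inv_def using is_blinfun_inverse_unique by (blast intro: the_equality)
  with B show "blinfun_inv A (A x) = x" "A (blinfun_inv A y) = y"
    unfolding is_blinfun_inverse_def
    by (metis blinfun_apply_blinfun_compose blinfun_apply_id_blinfun id_apply)+
qed

text \<open>The preconditioned operator is the identity plus a perturbation of norm at most
  \<open>q\<close>, so the reverse triangle inequality applies. It serves twice: for injectivity in
  the next lemma and for the length of a Newton step.\<close>

lemma norm_le_preconditioned:
  fixes A A0 :: "'a::real_normed_vector \<Rightarrow>\<^sub>L 'b::real_normed_vector"
  assumes A0: "blinfun_invertible A0"
    and q: "norm (blinfun_inv A0 o\<^sub>L (A - A0)) \<le> q"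
  shows "(1 - q) * norm h \<le> norm (blinfun_inv A0 (A h))"
proof -
  let ?E = "blinfun_inv A0 o\<^sub>L (A - A0)"
  have "blinfun_inv A0 (A h) = h + ?E h"
    by (simp add: blinfun.bilinear_simps blinfun_inv_inverse[OF A0])
  then have "norm h \<le> norm (blinfun_inv A0 (A h)) + norm (?E h)"
    using norm_triangle_ineq4[of "h + ?E h" "?E h"] by simp
  moreover have "norm (?E h) \<le> q * norm h"
    using norm_blinfun[of ?E h] mult_right_mono[OF q, of "norm h"] by simp
  ultimately show ?thesis
    by (simp add: algebra_simps)
qed

text \<open>Banach's perturbation lemma without a Neumann series: solving \<open>B (A h) = z\<close>
  means finding a fixed point of \<open>h \<mapsto> z - (B o\<^sub>L (A - A0)) h\<close>, a
  contraction of the complete space \<open>'a\<close>. The lower bound then gives both uniqueness of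
  the solution and boundedness of the inverse.\<close>

lemma blinfun_invertible_perturb:
  fixes A A0 :: "'a::banach \<Rightarrow>\<^sub>L 'b::real_normed_vector"
  assumes A0: "blinfun_invertible A0"
    and less: "norm (blinfun_inv A0 o\<^sub>L (A - A0)) < 1"
  shows "blinfun_invertible A"
proof -
  define B where "B = blinfun_inv A0"
  define q where "q = norm (B o\<^sub>L (A - A0))"
  note inv = blinfun_inv_inverse[OF A0, folded B_def]
  have q: "0 \<le> q" "q < 1"
    using less by (auto simp: q_def B_def)
  have lower: "(1 - q) * norm h \<le> norm (B (A h))" for h
    using norm_le_preconditioned[OF A0] by (simp add: q_def B_def)
  have inj: "h = h'" if "B (A h) = B (A h')" for h h'
    using lower[of "h - h'"] that q by (simp add: blinfun.bilinear_simps mult_le_0_iff)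
  have ex: "\<exists>h. B (A h) = z" for z
  proof -
    define f where "f = (\<lambda>h. z - (B o\<^sub>L (A - A0)) h)"
    have "dist (f h) (f h') \<le> q * dist h h'" for h h'
    proof -
      have "f h - f h' = (B o\<^sub>L (A - A0)) (h' - h)"
        by (simp add: f_def blinfun.bilinear_simps)
      then show ?thesis
        using norm_blinfun[of "B o\<^sub>L (A - A0)" "h' - h"]
        by (simp add: dist_norm q_def norm_minus_commute)
    qed
    then obtain h where "f h = h"
      using banach_fix_type[OF q] by metis
    then have "z = h + (B o\<^sub>L (A - A0)) h"
      by (simp add: f_def algebra_simps)
    then have "B (A h) = z"
      by (simp add: blinfun.bilinear_simps inv)
    then show ?thesis ..
  qed
  \<comment> \<open>\<open>s\<close> inverts the composite of \<open>B\<close> and \<open>A\<close>;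
    by \<open>inj\<close> the choice is forced, whence its linearity. The inverse of
    \<open>A\<close> is therefore \<open>s\<close> after \<open>B\<close>.\<close>
  define s where "s = (\<lambda>z. SOME h. B (A h) = z)"
  have s: "B (A (s z)) = z" for z
    unfolding s_def by (rule someI_ex[OF ex])
  have "bounded_linear s"
  proof (rule bounded_linear_intro)
    show "s (x + y) = s x + s y" for x y
      by (rule inj) (simp add: blinfun.bilinear_simps s)
    show "s (r *\<^sub>R x) = r *\<^sub>R s x" for r x
      by (rule inj) (simp add: blinfun.bilinear_simps s)
    show "norm (s x) \<le> norm x * (1 / (1 - q))" for x
      using lower[of "s x"] q by (simp add: s field_simps)
  qed
  then have S: "blinfun_apply (Blinfun s) = s"
    by (rule bounded_linear_Blinfun_apply)
  have "s (B (A x)) = x" for x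
    by (rule inj) (simp add: s)
  \<comment> \<open>Both sides have the same image under \<open>B\<close>, and \<open>B\<close> is
    injective because \<open>F' x0\<close>, here \<open>A0\<close>, undoes it.\<close>
  moreover have "A (s (B y)) = y" for y
    using inv(2)[of "A (s (B y))"] inv(2)[of y] by (simp add: s)
  ultimately have "is_blinfun_inverse A (Blinfun s o\<^sub>L B)"
    unfolding is_blinfun_inverse_def by (auto intro!: blinfun_eqI simp: S)
  then show ?thesis
    using blinfun_invertible_def by blast
qed

section \<open>Mean value estimate for the linearisation error\<close>

text \<open>Along the segment, the derivative of the error is split through \<open>F' x0\<close>,
  which bounds it by \<open>\<omega> t + \<omega> a\<close>. Integration gives the integral of
  \<open>\<omega>\<close> plus \<open>(b - a) * \<omega> a\<close>; by monotonicity the latter is at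
  most the same integral, hence the factor 2.\<close>

lemma linearization_error_bound:
  fixes F :: "'a::real_normed_vector \<Rightarrow> 'b::real_normed_vector"
    and F' :: "'a \<Rightarrow> 'a \<Rightarrow>\<^sub>L 'b"
    and L :: "'b \<Rightarrow>\<^sub>L 'c::real_normed_vector"
    and \<omega> :: "real \<Rightarrow> real"
  assumes deriv: "\<And>x. x \<in> cball x0 R \<Longrightarrow> (F has_derivative F' x) (at x)"
    and cont: "continuous_on {0..R} \<omega>"
    and mono: "mono_on {0..R} \<omega>"
    and center: "\<And>x r. norm (x - x0) \<le> r \<Longrightarrow> r \<le> R \<Longrightarrow> norm (L o\<^sub>L (F' x - F' x0)) \<le> \<omega> r"
    and ab: "0 \<le> a" "a \<le> b" "b \<le> R"
    and x: "norm (x - x0) \<le> a" and y: "norm (y - x) \<le> b - a"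
  shows "norm (L (F y - F x - F' x (y - x))) \<le> 2 * integral {a..b} \<omega>"
proof (cases "a = b")
  case True
  with y show ?thesis
    by (simp add: blinfun.bilinear_simps)
next
  case False
  with ab have "a < b"
    by simp
  \<comment> \<open>The segment is parametrised by [a, b] rather than by its length, so that
    \<open>p t\<close> lies within distance t of \<open>x0\<close>. Hence \<open>e\<close> need not
    be a unit vector; norm at most 1 suffices.\<close>
  define e where "e = (1 / (b - a)) *\<^sub>R (y - x)"
  have e: "norm e \<le> 1" "y - x = (b - a) *\<^sub>R e"
    using y \<open>a < b\<close> unfolding e_def norm_scaleR by (simp_all only: scaleR_scaleR) (simp_all add: field_simps)
  define p where "p = (\<lambda>t. x + (t - a) *\<^sub>R e)"
  have p: "norm (p t - x0) \<le> t" if "a \<le> t" for t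
  proof -
    have "norm (p t - x0) \<le> norm (x - x0) + norm ((t - a) *\<^sub>R e)"
      unfolding p_def by (metis add_diff_eq add.commute norm_triangle_ineq)
    moreover have "norm ((t - a) *\<^sub>R e) \<le> t - a"
      using that e(1) mult_left_mono[of "norm e" 1 "t - a"] by simp
    ultimately show ?thesis
      using x by linarith
  qed
  \<comment> \<open>The increment of \<open>g\<close> over [a, b] is the linearisation error seen
    through \<open>L\<close>; \<open>\<phi>\<close> below is its scalar majorant.\<close>
  define g where "g = (\<lambda>t. L (F (p t) - (t - a) *\<^sub>R F' x e))"
  define g' where "g' = (\<lambda>t. L (F' (p t) e - F' x e))"
  define \<phi> where "\<phi> = (\<lambda>t. integral {a..t} \<omega> + (t - a) * \<omega> a)"
  have cont_ab: "continuous_on {a..b} \<omega>"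
    using cont by (rule continuous_on_subset) (use ab in auto)
  have g_deriv: "(g has_vector_derivative g' t) (at t)" if "a \<le> t" "t \<le> b" for t
  proof -
    have "p t \<in> cball x0 R"
      using p[of t] that ab by (simp add: dist_norm norm_minus_commute)
    then have "(F has_derivative F' (p t)) (at (p t))"
      by (rule deriv)
    moreover have "(p has_derivative (\<lambda>h. h *\<^sub>R e)) (at t)"
      unfolding p_def by (auto intro!: derivative_eq_intros)
    ultimately have "((\<lambda>t. F (p t)) has_derivative (\<lambda>h. F' (p t) (h *\<^sub>R e))) (at t)"
      by (rule has_derivative_compose[rotated])
    then show ?thesis
      unfolding g_def g'_def has_vector_derivative_def
      by (auto intro!: derivative_eq_intros simp: blinfun.bilinear_simps algebra_simps)
  qed
  have \<phi>_deriv: "(\<phi> has_vector_derivative (\<omega> t + \<omega> a)) (at t within {a..b})"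
    if "a \<le> t" "t \<le> b" for t
    unfolding \<phi>_def using integral_has_vector_derivative[OF cont_ab, of t] that
    by (auto intro!: derivative_eq_intros)
  have bound: "norm (g' t) \<le> \<omega> t + \<omega> a" if "a < t" "t < b" for t
  proof -
    have "g' t = (L o\<^sub>L (F' (p t) - F' x0)) e - (L o\<^sub>L (F' x - F' x0)) e"
      by (simp add: g'_def blinfun.bilinear_simps)
    moreover have "norm ((L o\<^sub>L (F' z - F' x0)) e) \<le> \<omega> r" if "norm (z - x0) \<le> r" "r \<le> R" for z r
    proof -
      have "norm ((L o\<^sub>L (F' z - F' x0)) e) \<le> norm (L o\<^sub>L (F' z - F' x0)) * norm e"
        by (rule norm_blinfun)
      also have "\<dots> \<le> norm (L o\<^sub>L (F' z - F' x0))"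
        using e(1) by (simp add: mult_left_le)
      also have "\<dots> \<le> \<omega> r"
        using that by (rule center)
      finally show ?thesis .
    qed
    ultimately show ?thesis
      using p[of t] x that ab
      by (smt (verit) norm_triangle_ineq4)
  qed
  have "norm (g b - g a) \<le> \<phi> b - \<phi> a"
  proof (rule differentiable_bound_general[OF \<open>a < b\<close>])
    show "continuous_on {a..b} g"
      by (intro continuous_at_imp_continuous_on ballI has_vector_derivative_continuous[OF g_deriv]) auto
    show "continuous_on {a..b} \<phi>"
      unfolding continuous_on_eq_continuous_within
      by (intro ballI has_vector_derivative_continuous[OF \<phi>_deriv]) auto
    show "(\<phi> has_vector_derivative (\<omega> t + \<omega> a)) (at t)" if "a < t" "t < b" for t
      using \<phi>_deriv[of t] that by (simp add: at_within_Icc_at)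
  qed (use g_deriv bound in auto)
  moreover have "g b - g a = L (F y - F x - F' x (y - x))"
    by (simp add: g_def p_def e(2)[symmetric] blinfun.scaleR_right[symmetric] blinfun.diff_right)
  moreover have "(b - a) * \<omega> a \<le> integral {a..b} \<omega>"
  proof -
    have "integral {a..b} (\<lambda>_. \<omega> a) \<le> integral {a..b} \<omega>"
    proof (rule integral_le)
      show "\<omega> a \<le> \<omega> t" if "t \<in> {a..b}" for t
        using that ab by (intro mono_onD[OF mono]) auto
    qed (use cont_ab in \<open>auto intro: integrable_continuous_real\<close>)
    then show ?thesis
      using ab by simp
  qed
  ultimately show ?thesis
    by (simp add: \<phi>_def)
qed

section \<open>Scalar majorizing sequences\<close>

text \<open>Monotonicity of \<open>f\<close> propagates \<open>u k \<le> u (Suc k) \<le> s\<close>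
  from the start at 0. The limit is a fixed point by continuity and lies below \<open>s\<close>, so
  minimality of \<open>s\<close> identifies the two.\<close>

lemma fixed_point_iteration_tendsto:
  fixes f :: "real \<Rightarrow> real" and u :: "nat \<Rightarrow> real"
  assumes cont: "continuous_on {0..b} f"
    and mono: "mono_on {0..b} f"
    and nonneg: "0 \<le> f 0"
    and fixp: "f s = s"
    and least: "\<And>t. t \<in> {0..b} \<Longrightarrow> t = f t \<Longrightarrow> s \<le> t"
    and s: "0 \<le> s" "s \<le> b"
    and u0: "u 0 = 0" and uSuc: "\<And>k. u (Suc k) = f (u k)"
  shows "incseq u" and "\<And>k. u k \<in> {0..s}" and "u \<longlonglongrightarrow> s"
proof -
  have step: "0 \<le> u k \<and> u k \<le> u (Suc k) \<and> u (Suc k) \<le> s" for k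
  proof (induction k)
    case 0
    show ?case
      using mono_onD[OF mono, of 0 s] s nonneg by (simp add: u0 uSuc fixp)
  next
    case (Suc k)
    then show ?case
      using mono_onD[OF mono, of "u k" "u (Suc k)"] mono_onD[OF mono, of "u (Suc k)" s] s
      by (simp add: uSuc fixp)
  qed
  show inc: "incseq u"
    using step by (simp add: incseq_Suc_iff)
  show bd: "u k \<in> {0..s}" for k
    using step[of k] by auto
  have in_b: "u k \<in> {0..b}" for k
    using bd[of k] s by auto
  have "\<forall>k. u k \<le> s"
    using bd by auto
  with inc obtain l where l: "u \<longlonglongrightarrow> l"
    using incseq_convergent by blast
  have l_in: "l \<in> {0..s}"
    using closed_sequentially[of "{0..s}" u, OF closed_atLeastAtMost _ l] bd by blast
  have "(\<lambda>k. f (u k)) \<longlonglongrightarrow> f l"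
    using cont l by (rule continuous_on_tendsto_compose) (use l_in in_b s in auto)
  moreover have "(\<lambda>k. f (u k)) \<longlonglongrightarrow> l"
    using LIMSEQ_Suc[OF l] by (simp add: uSuc)
  ultimately have "l = f l"
    using LIMSEQ_unique by blast
  with least[of l] l_in s have "l = s"
    by auto
  with l show "u \<longlonglongrightarrow> s"
    by simp
qed

text \<open>Telescoping bounds every difference of iterates by the matching difference of
  \<open>u\<close>. This carries the Cauchy property over to \<open>x\<close>, and letting the later
  index tend to infinity gives the error bound.\<close>

lemma majorized_tendsto:
  fixes x :: "nat \<Rightarrow> 'a::banach" and u :: "nat \<Rightarrow> real"
  assumes step: "\<And>k. norm (x (Suc k) - x k) \<le> u (Suc k) - u k"
    and lim: "u \<longlonglongrightarrow> s"
  obtains l where "x \<longlonglongrightarrow> l" and "\<And>k. norm (l - x k) \<le> s - u k"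
proof -
  have maj: "norm (x (k + n) - x k) \<le> u (k + n) - u k" for k n
  proof (induction n)
    case (Suc n)
    have "norm (x (k + Suc n) - x k) \<le> norm (x (Suc (k + n)) - x (k + n)) + norm (x (k + n) - x k)"
      by (metis add_Suc_right diff_add_cancel diff_diff_eq2 norm_triangle_ineq add_diff_eq)
    with Suc step[of "k + n"] show ?case
      by simp
  qed simp
  have "Cauchy x"
  proof (rule CauchyI)
    fix e :: real
    assume "0 < e"
    then obtain M where M: "\<And>m n. m \<ge> M \<Longrightarrow> n \<ge> M \<Longrightarrow> dist (u m) (u n) < e"
      using LIMSEQ_imp_Cauchy[OF lim] unfolding Cauchy_def by blast
    have "norm (x m - x n) < e" if "M \<le> m" "m \<le> n" for m n
      using maj[of m "n - m"] M[of m n] that by (auto simp: dist_norm norm_minus_commute)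
    then show "\<exists>M. \<forall>m\<ge>M. \<forall>n\<ge>M. norm (x m - x n) < e"
      by (meson linorder_le_cases norm_minus_commute[THEN eq_refl, THEN le_less_trans])
  qed
  then obtain l where l: "x \<longlonglongrightarrow> l"
    using Cauchy_convergent convergent_def by blast
  have "norm (l - x k) \<le> s - u k" for k
  proof (rule LIMSEQ_le)
    show "(\<lambda>n. norm (x (n + k) - x k)) \<longlonglongrightarrow> norm (l - x k)"
      by (intro tendsto_intros LIMSEQ_ignore_initial_segment l)
    show "(\<lambda>n. u (n + k) - u k) \<longlonglongrightarrow> s - u k"
      by (intro tendsto_intros LIMSEQ_ignore_initial_segment lim)
    show "\<exists>N. \<forall>n\<ge>N. norm (x (n + k) - x k) \<le> u (n + k) - u k"
      using maj[of k] by (auto simp: add.commute)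
  qed
  with l show thesis
    using that by blast
qed

section \<open>Semilocal convergence of the Newton iteration\<close>

theorem mainTheorem1:
  fixes F :: "'a::banach \<Rightarrow> 'b::banach"
    and F' :: "'a \<Rightarrow> 'a \<Rightarrow>\<^sub>L 'b"
    and D :: "'a set"
    and x0 :: 'a
    and \<eta> R \<upsilon>s :: real
    and \<omega>0 \<psi> :: "real \<Rightarrow> real"
    and \<upsilon> :: "nat \<Rightarrow> real"
  assumes D_open: "open D"
    and F_deriv: "\<And>x. x \<in> D \<Longrightarrow> (F has_derivative blinfun_apply (F' x)) (at x)"
    and F'_cont: "continuous_on D F'"
    and x0_in: "x0 \<in> D"
    and F'_x0_inv: "blinfun_invertible (F' x0)"
    and eta_pos: "\<eta> > 0"
    and R_pos: "R > 0"
    and ball_sub: "cball x0 R \<subseteq> D"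
    and omega_cont: "continuous_on {0..R} \<omega>0"
    and omega_mono: "mono_on {0..R} \<omega>0"
    and omega_nonneg: "\<And>t. t \<in> {0..R} \<Longrightarrow> 0 \<le> \<omega>0 t"
    and omega_0: "\<omega>0 0 = 0"
    and F_x0: "norm (blinfun_apply (blinfun_inv (F' x0)) (F x0)) \<le> \<eta>"
    and F'_center: "\<And>x r. norm (x - x0) \<le> r \<Longrightarrow> r \<le> R \<Longrightarrow>
          norm (blinfun_inv (F' x0) o\<^sub>L (F' x - F' x0)) \<le> \<omega>0 r"
    and omega_ne: "\<And>t. t \<in> {0..R} \<Longrightarrow> 1 - \<omega>0 t \<noteq> 0"
    and psi_eq: "\<And>t. t \<in> {0..R} \<Longrightarrow>
          \<psi> t = \<eta> + 2 * inverse (1 - \<omega>0 t) * integral {0..t} \<omega>0"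
    and psi_cont: "continuous_on {0..R} \<psi>"
    and psi_mono: "mono_on {0..R} \<psi>"
    and psi_nonneg: "\<And>t. t \<in> {0..R} \<Longrightarrow> 0 \<le> \<psi> t"
    and fix_sol: "\<upsilon>s = \<psi> \<upsilon>s"
    and fix_min: "\<And>t. t \<in> {0..R} \<Longrightarrow> t = \<psi> t \<Longrightarrow> \<upsilon>s \<le> t"
    and fix_bounds: "\<eta> < \<upsilon>s" "\<upsilon>s \<le> R"
    and ups_0: "\<upsilon> 0 = 0"
    and ups_1: "\<upsilon> 1 = \<eta>"
    and ups_Suc: "\<And>k. \<upsilon> (Suc k) = \<psi> (\<upsilon> k)"
  shows "(\<forall>k. newton_seq F F' x0 k \<in> D \<and> blinfun_invertible (F' (newton_seq F F' x0 k)))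
    \<and> (\<forall>k. newton_seq F F' x0 k \<in> cball x0 \<upsilon>s)
    \<and> (\<exists>xs \<in> D. F xs = 0 \<and> newton_seq F F' x0 \<longlonglongrightarrow> xs
         \<and> (\<forall>k. norm (newton_seq F F' x0 (Suc k) - newton_seq F F' x0 k) \<le> \<upsilon> (Suc k) - \<upsilon> k
              \<and> norm (xs - newton_seq F F' x0 k) \<le> \<upsilon>s - \<upsilon> k))
    \<and> incseq \<upsilon> \<and> \<upsilon> \<longlonglongrightarrow> \<upsilon>s"
proof -
  let ?x = "newton_seq F F' x0"
  define L where "L = blinfun_inv (F' x0)"
  \<comment> \<open>The hypothesis only says that \<open>\<omega>0\<close> avoids the value 1; since
    it starts at 0, the intermediate value theorem keeps it below 1.\<close>
  have omega_less: "\<omega>0 t < 1" if t: "t \<in> {0..R}" for t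
  proof (rule ccontr)
    assume "\<not> \<omega>0 t < 1"
    then obtain c where "0 \<le> c" "c \<le> t" "\<omega>0 c = 1"
      using IVT'[of \<omega>0 0 1 t] t omega_0 continuous_on_subset[OF omega_cont, of "{0..t}"] by auto
    with omega_ne[of c] t show False
      by auto
  qed
  have psi_0: "\<psi> 0 = \<eta>"
    using ups_0 ups_1 ups_Suc[of 0] by simp
  have s: "0 \<le> \<upsilon>s" "\<upsilon>s \<le> R"
    using eta_pos fix_bounds by auto
  have "0 \<le> \<psi> 0"
    using psi_0 eta_pos by simp
  note scalar = fixed_point_iteration_tendsto[OF psi_cont psi_mono this fix_sol[symmetric]
      fix_min s ups_0 ups_Suc]
  have ups_in: "\<upsilon> k \<in> {0..R}" for k
    using scalar(2)[of k] s by auto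
  have ups_le: "\<upsilon> k \<le> \<upsilon> (Suc k)" for k
    using scalar(1) by (simp add: incseq_SucD)
  \<comment> \<open>The centre condition is taken with r = R, so the single bound
    \<open>\<omega>0 R < 1\<close> covers the whole ball.\<close>
  have inv_at: "blinfun_invertible (F' x)" if "norm (x - x0) \<le> R" for x
    using blinfun_invertible_perturb[OF F'_x0_inv] F'_center[OF that] omega_less[of R] R_pos
    by force
  have newton: "F' (?x k) (?x (Suc k) - ?x k) = - F (?x k)" if "norm (?x k - x0) \<le> R" for k
    using blinfun_inv_inverse(2)[OF inv_at[OF that]] by (simp add: blinfun.bilinear_simps)
  have psi_step: "2 * integral {\<upsilon> k..\<upsilon> (Suc k)} \<omega>0
      \<le> (1 - \<omega>0 (\<upsilon> (Suc k))) * (\<upsilon> (Suc (Suc k)) - \<upsilon> (Suc k))" for k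
  proof -
    let ?a = "\<upsilon> k" and ?b = "\<upsilon> (Suc k)"
    define A B where "A = integral {0..?a} \<omega>0" and "B = integral {0..?b} \<omega>0"
    have int: "\<omega>0 integrable_on {0..?b}"
      using continuous_on_subset[OF omega_cont, of "{0..?b}"] ups_in[of "Suc k"]
      by (auto intro: integrable_continuous_real)
    have AB: "B = A + integral {?a..?b} \<omega>0"
      using Henstock_Kurzweil_Integration.integral_combine[OF _ ups_le int] ups_in[of k]
      by (simp add: A_def B_def)
    have "0 \<le> A"
      unfolding A_def using omega_nonneg ups_in[of k]
      by (intro integral_nonneg integrable_continuous_real continuous_on_subset[OF omega_cont]) auto
    have less: "\<omega>0 ?a < 1" "\<omega>0 ?b < 1" and le: "\<omega>0 ?a \<le> \<omega>0 ?b"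
      using omega_less ups_in ups_le by (auto intro!: mono_onD[OF omega_mono])
    \<comment> \<open>Multiplying \<open>\<psi> ?b - \<psi> ?a\<close> by
      \<open>1 - \<omega>0 ?b\<close> clears the denominator at \<open>?b\<close> and leaves
      \<open>A\<close> weighted by this ratio, which is at most 1 because \<open>\<omega>0\<close>
      is non-decreasing.\<close>
    have "A * ((1 - \<omega>0 ?b) / (1 - \<omega>0 ?a)) \<le> A"
      using less le \<open>0 \<le> A\<close> by (intro mult_left_le) auto
    moreover have "(1 - \<omega>0 ?b) * (\<psi> ?b - \<psi> ?a) = 2 * B - 2 * (A * ((1 - \<omega>0 ?b) / (1 - \<omega>0 ?a)))"
    proof -
      have "(1 - \<omega>0 ?b) * (\<psi> ?b - \<psi> ?a)
          = 2 * ((1 - \<omega>0 ?b) * inverse (1 - \<omega>0 ?b)) * B - 2 * (A * ((1 - \<omega>0 ?b) / (1 - \<omega>0 ?a)))"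
        unfolding psi_eq[OF ups_in] A_def[symmetric] B_def[symmetric] divide_inverse by algebra
      then show ?thesis
        using less by simp
    qed
    ultimately show ?thesis
      using AB by (simp add: ups_Suc)
  qed
  \<comment> \<open>The two bounds need a joint induction: their sum places the next iterate in the
    ball, where the next step can be estimated.\<close>
  have main: "norm (?x k - x0) \<le> \<upsilon> k \<and> norm (?x (Suc k) - ?x k) \<le> \<upsilon> (Suc k) - \<upsilon> k" for k
  proof (induction k)
    case 0
    show ?case
      using F_x0 ups_0 ups_1 by simp
  next
    case (Suc k)
    let ?h = "?x (Suc (Suc k)) - ?x (Suc k)"
    have R: "norm (?x k - x0) \<le> R"
      using Suc ups_in[of k] by (auto simp del: newton_seq.simps)
    have near: "norm (?x (Suc k) - x0) \<le> \<upsilon> (Suc k)"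
      using Suc norm_triangle_ineq[of "?x (Suc k) - ?x k" "?x k - x0"]
      by (simp del: newton_seq.simps)
    then have R': "norm (?x (Suc k) - x0) \<le> R"
      using ups_in[of "Suc k"] by (auto simp del: newton_seq.simps)
    have "(1 - \<omega>0 (\<upsilon> (Suc k))) * norm ?h \<le> norm (L (F' (?x (Suc k)) ?h))"
      unfolding L_def using near ups_in[of "Suc k"]
      by (intro norm_le_preconditioned F'_x0_inv F'_center) auto
    \<comment> \<open>The Newton equation is used at both indices: at \<open>Suc k\<close> it turns
      the left side into \<open>- F (?x (Suc k))\<close>, whose sign the norm absorbs, and at
      \<open>k\<close> it makes the two subtracted terms cancel.\<close>
    also have "\<dots> = norm (L (F (?x (Suc k)) - F (?x k) - F' (?x k) (?x (Suc k) - ?x k)))"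
      unfolding newton[OF R] newton[OF R'] by (simp add: blinfun.minus_right del: newton_seq.simps)
    also have "\<dots> \<le> 2 * integral {\<upsilon> k..\<upsilon> (Suc k)} \<omega>0"
    proof (rule linearization_error_bound[OF _ omega_cont omega_mono])
      show "(F has_derivative F' x) (at x)" if "x \<in> cball x0 R" for x
        using that ball_sub F_deriv by blast
      show "norm (L o\<^sub>L (F' x - F' x0)) \<le> \<omega>0 r" if "norm (x - x0) \<le> r" "r \<le> R" for x r
        unfolding L_def using that by (rule F'_center)
    qed (use Suc ups_in ups_le in \<open>auto simp del: newton_seq.simps\<close>)
    also have "\<dots> \<le> (1 - \<omega>0 (\<upsilon> (Suc k))) * (\<upsilon> (Suc (Suc k)) - \<upsilon> (Suc k))"
      by (rule psi_step)
    finally have "norm ?h \<le> \<upsilon> (Suc (Suc k)) - \<upsilon> (Suc k)"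
      using omega_less[OF ups_in[of "Suc k"]] by (simp del: newton_seq.simps)
    with near show ?case
      by blast
  qed
  have near: "norm (?x k - x0) \<le> \<upsilon>s" for k
    using main[of k] scalar(2)[of k] by auto
  have in_R: "norm (?x k - x0) \<le> R" for k
    using near[of k] s by linarith
  have in_D: "x \<in> D" if "norm (x - x0) \<le> R" for x
    using that ball_sub by (auto simp: dist_norm norm_minus_commute)
  obtain xs where lim: "?x \<longlonglongrightarrow> xs" and err: "\<And>k. norm (xs - ?x k) \<le> \<upsilon>s - \<upsilon> k"
    using majorized_tendsto[of ?x \<upsilon> \<upsilon>s] main scalar(3) by blast
  have xs_D: "xs \<in> D"
    using err[of 0] ups_0 s by (intro in_D) simp
  \<comment> \<open>The Newton equation is passed to the limit: the derivatives converge and the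
    steps tend to 0, so the residuals \<open>F (?x k)\<close> vanish in the limit.\<close>
  have "(\<lambda>k. F' (?x k)) \<longlonglongrightarrow> F' xs"
    using F'_cont lim xs_D by (rule continuous_on_tendsto_compose) (simp add: in_D in_R)
  moreover have "(\<lambda>k. ?x (Suc k) - ?x k) \<longlonglongrightarrow> xs - xs"
    by (intro tendsto_diff LIMSEQ_Suc lim)
  ultimately have "(\<lambda>k. F' (?x k) (?x (Suc k) - ?x k)) \<longlonglongrightarrow> F' xs (xs - xs)"
    by (rule blinfun.tendsto)
  then have "(\<lambda>k. - F (?x k)) \<longlonglongrightarrow> 0"
    by (simp only: newton[OF in_R] diff_self blinfun.zero_right)
  moreover have "(\<lambda>k. - F (?x k)) \<longlonglongrightarrow> - F xs"
    using has_derivative_continuous[OF F_deriv[OF xs_D]] lim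
    by (intro tendsto_minus isCont_tendsto_compose[of xs F]) auto
  ultimately have "F xs = 0"
    using LIMSEQ_unique by fastforce
  with lim err xs_D main near in_D in_R inv_at scalar(1,3) show ?thesis
    by (auto simp: dist_norm norm_minus_commute simp del: newton_seq.simps)
qed

end
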